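(* There exists a deterministic algorithm in the congested clique model that, given a directed graph $G=(V,E)$ with $n$ vertices, $m$ edges, unit capacities on all edges, integer costs $c\colon E\to\{1,2,\dots,W\}$, and a demand vector $\sigma\colon V\to\mathbb{Z}$ with $\sum_{v\in V}\sigma(v)=0$, solves the minimum cost flow problem in $\tilde O\big(m^{3/7}(n^{0.158}+n^{o(1)}\,\mathrm{poly}\log W)\big)$ rounds.
   Context: Congested clique model: there are $n$ processors (nodes), one per vertex of the input graph, each with a unique $O(\log n)$-bit identifier; computation proceeds in synchronous rounds, and in each round every node may send a (possibly different) message of $O(\log n)$ bits to every other node. Initially each node knows only its incident edges together with their capacities and costs, and its own demand; complexity is the number of rounds. A feasible flow is $f\colon E\to\mathbb{R}_{\ge 0}$ with $f_e\le 1$ for all $e$ and, at every vertex $v$, net flow (out minus in) equal to $\sigma(v)$. Its cost is $\sum_{e}c_ef_e$; the minimum cost flow problem asks for a feasible flow of minimum cost. $\tilde O$ hides polylogarithmic factors. *)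

theory Defs
  imports
    "HOL-Analysis.Analysis"
    "HOL-Computational_Algebra.Polynomial"
    "Graph_Theory.Pair_Digraph"
begin

section \<open>Minimum cost flow with unit capacities\<close>

definition feasible_flow ::
  "'v pair_pre_digraph \<Rightarrow> ('v \<Rightarrow> int) \<Rightarrow> ('v \<times> 'v \<Rightarrow> real) \<Rightarrow> bool" where
  "feasible_flow G \<sigma> f \<longleftrightarrow>
     (\<forall>e\<in>parcs G. 0 \<le> f e \<and> f e \<le> 1) \<and>
     (\<forall>v\<in>pverts G. (\<Sum>e\<in>out_arcs G v. f e) - (\<Sum>e\<in>in_arcs G v. f e) = of_int (\<sigma> v))"

definition flow_cost ::
  "'v pair_pre_digraph \<Rightarrow> ('v \<times> 'v \<Rightarrow> nat) \<Rightarrow> ('v \<times> 'v \<Rightarrow> real) \<Rightarrow> real" where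
  "flow_cost G c f = (\<Sum>e\<in>parcs G. real (c e) * f e)"

definition min_cost_flow ::
  "'v pair_pre_digraph \<Rightarrow> ('v \<times> 'v \<Rightarrow> nat) \<Rightarrow> ('v \<Rightarrow> int) \<Rightarrow> ('v \<times> 'v \<Rightarrow> real) \<Rightarrow> bool" where
  "min_cost_flow G c \<sigma> f \<longleftrightarrow>
     feasible_flow G \<sigma> f \<and>
     (\<forall>g. feasible_flow G \<sigma> g \<longrightarrow> flow_cost G c f \<le> flow_cost G c g)"


section \<open>The congested clique\<close>

text \<open>
  A node is its identifier, a natural number; the clique consists of the vertices of the input
  graph. Messages are bit strings, the empty string standing for silence. Local computation is
  unrestricted, so a deterministic algorithm is a pair of functions of everything a node has seen
  so far: its own input and the list of its inboxes, one per past round.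
  An inbox maps the identifier of each other node to the message received from it; it is
  undefined outside the clique. In particular, a node learns which nodes exist only in the
  first round.
\<close>

type_synonym inbox = "nat \<rightharpoonup> bool list"

text \<open>All capacities are 1, so an incident edge is recorded together with its cost only.\<close>

record local_input =
  own_id :: nat
  own_edges :: "((nat \<times> nat) \<times> nat) set"
  own_demand :: int

text \<open>The function in a \<open>Flow\<close> result is only relevant on the edges incident to the node.\<close>

datatype flow_result = Flow "nat \<times> nat \<Rightarrow> real" | Infeasible

text \<open>
  The field \<open>send\<close> gives the message for each recipient, and \<open>decide\<close> the result of the node, or
  \<open>None\<close> while it has not finished.
\<close>

record cc_algorithm =
  send :: "local_input \<Rightarrow> inbox list \<Rightarrow> nat \<Rightarrow> bool list"
  decide :: "local_input \<Rightarrow> inbox list \<Rightarrow> flow_result option"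

definition incident_arcs :: "nat pair_pre_digraph \<Rightarrow> nat \<Rightarrow> (nat \<times> nat) set" where
  "incident_arcs G v = out_arcs G v \<union> in_arcs G v"

definition input_of ::
  "nat pair_pre_digraph \<Rightarrow> (nat \<times> nat \<Rightarrow> nat) \<Rightarrow> (nat \<Rightarrow> int) \<Rightarrow> nat \<Rightarrow> local_input" where
  "input_of G c \<sigma> v =
     \<lparr>own_id = v, own_edges = (\<lambda>e. (e, c e)) ` incident_arcs G v, own_demand = \<sigma> v\<rparr>"

primrec inboxes ::
  "cc_algorithm \<Rightarrow> nat pair_pre_digraph \<Rightarrow> (nat \<times> nat \<Rightarrow> nat) \<Rightarrow> (nat \<Rightarrow> int) \<Rightarrow>
   nat \<Rightarrow> nat \<Rightarrow> inbox list" where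
  "inboxes A G c \<sigma> 0 v = []"
| "inboxes A G c \<sigma> (Suc t) v = inboxes A G c \<sigma> t v @
     [\<lambda>u. if u \<in> pverts G - {v}
          then Some (send A (input_of G c \<sigma> u) (inboxes A G c \<sigma> t u) v) else None]"

definition decision ::
  "cc_algorithm \<Rightarrow> nat pair_pre_digraph \<Rightarrow> (nat \<times> nat \<Rightarrow> nat) \<Rightarrow> (nat \<Rightarrow> int) \<Rightarrow>
   nat \<Rightarrow> nat \<Rightarrow> flow_result option" where
  "decision A G c \<sigma> t v = decide A (input_of G c \<sigma> v) (inboxes A G c \<sigma> t v)"

text \<open>Results are irrevocable: only the first decision of a node counts.\<close>

definition has_output ::
  "cc_algorithm \<Rightarrow> nat pair_pre_digraph \<Rightarrow> (nat \<times> nat \<Rightarrow> nat) \<Rightarrow> (nat \<Rightarrow> int) \<Rightarrow>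
   nat \<Rightarrow> nat \<Rightarrow> flow_result \<Rightarrow> bool" where
  "has_output A G c \<sigma> T v r \<longleftrightarrow>
     (\<exists>t\<le>T. decision A G c \<sigma> t v = Some r \<and> (\<forall>s<t. decision A G c \<sigma> s v = None))"

text \<open>The constant \<open>b\<close> is the one hidden in the message length \<open>O(log n)\<close>.\<close>

definition respects_bandwidth ::
  "nat \<Rightarrow> cc_algorithm \<Rightarrow> nat pair_pre_digraph \<Rightarrow> (nat \<times> nat \<Rightarrow> nat) \<Rightarrow> (nat \<Rightarrow> int) \<Rightarrow>
   nat \<Rightarrow> bool" where
  "respects_bandwidth b A G c \<sigma> T \<longleftrightarrow>
     (\<forall>t<T. \<forall>u\<in>pverts G. \<forall>v\<in>pverts G - {u}.
        real (length (send A (input_of G c \<sigma> u) (inboxes A G c \<sigma> t u) v))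
          \<le> real b * log 2 (real (card (pverts G))))"

text \<open>
  The results of the nodes must fit together to one optimal flow; if there is no feasible flow,
  all nodes have to report this.
\<close>

definition solves_min_cost_flow ::
  "nat \<Rightarrow> cc_algorithm \<Rightarrow> nat pair_pre_digraph \<Rightarrow> (nat \<times> nat \<Rightarrow> nat) \<Rightarrow> (nat \<Rightarrow> int) \<Rightarrow>
   nat \<Rightarrow> bool" where
  "solves_min_cost_flow b A G c \<sigma> T \<longleftrightarrow>
     respects_bandwidth b A G c \<sigma> T \<and>
     (if \<exists>f. feasible_flow G \<sigma> f
      then \<exists>f. min_cost_flow G c \<sigma> f \<and>
             (\<forall>v\<in>pverts G. \<exists>g. has_output A G c \<sigma> T v (Flow g) \<and>
                (\<forall>e\<in>incident_arcs G v. g e = f e))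
      else \<forall>v\<in>pverts G. has_output A G c \<sigma> T v Infeasible)"

end

theory Submission
  imports Defs
begin

text \<open>
  Local computation is free, so it suffices that every node learns the whole instance. Up to
  polylogarithmic factors in \<open>n\<close> and \<open>W\<close>, the instance has \<open>m + n\<close> bits, and since each node receives
  \<open>n - 1\<close> messages per round, gathering it takes \<open>m / n + 1\<close> rounds once the bits are spread evenly over
  the nodes. As \<open>m \<le> n\<^sup>2\<close>, we have \<open>m / n \<le> m\<^bsup>3/7\<^esup> n\<^bsup>1/7\<^esup>\<close>, and \<open>1/7 < 0.158\<close>. One-bit messages suffice.
\<close>

section \<open>Protocols with messages to oneself\<close>

text \<open>Three features of the model shape the construction. A node knows neither
  \<open>n\<close> nor \<open>W\<close> nor how much the others hold, so each phase must end at a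
  moment that all nodes can compute from broadcast data. No node sends to itself, whereas a rule
  based on ranks may name the sender as receiver, so protocols are designed with messages to oneself
  and simulated afterwards. And the demands are not bounded in terms of \<open>n\<close> and
  \<open>W\<close>, so they cannot be transmitted literally in time; unit capacities help, since a
  demand beyond the degree already excludes feasibility and one code can stand for all such values.
  The gathered strings then fix the instance only up to data that do not affect the answer. The code
  lengths bring a factor log W to all of m/n, while the target pairs poly log W only with n^o(1).
  The gap between 1/7 and 0.158 makes up for this.\<close>

primrec transcript ::
  "(local_input \<Rightarrow> inbox list \<Rightarrow> nat \<Rightarrow> bool list) \<Rightarrow> nat set \<Rightarrow> (nat \<Rightarrow> local_input) \<Rightarrow>
   nat \<Rightarrow> nat \<Rightarrow> inbox list" where
  "transcript P V I 0 v = []"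
| "transcript P V I (Suc t) v = transcript P V I t v @
     [\<lambda>u. if u \<in> V then Some (P (I u) (transcript P V I t u) v) else None]"

lemma length_transcript [simp]: "length (transcript P V I t v) = t"
  by (induction t) auto

lemma nth_transcript:
  "s < t \<Longrightarrow> transcript P V I t v ! s =
     (\<lambda>u. if u \<in> V then Some (P (I u) (transcript P V I s u) v) else None)"
  by (induction t) (auto simp: nth_append less_Suc_eq)

text \<open>The history extended by the messages that the node sent to itself, which it can recompute.\<close>

definition complete ::
  "(local_input \<Rightarrow> inbox list \<Rightarrow> nat \<Rightarrow> bool list) \<Rightarrow> local_input \<Rightarrow> inbox list \<Rightarrow> inbox list" where
  "complete P i h = foldl (\<lambda>acc ib. acc @ [ib(own_id i \<mapsto> P i acc (own_id i))]) [] h"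

definition self_free ::
  "(local_input \<Rightarrow> inbox list \<Rightarrow> nat \<Rightarrow> bool list) \<Rightarrow>
   (local_input \<Rightarrow> inbox list \<Rightarrow> flow_result option) \<Rightarrow> cc_algorithm" where
  "self_free P D = \<lparr>send = (\<lambda>i h. P i (complete P i h)), decide = (\<lambda>i h. D i (complete P i h))\<rparr>"

lemma complete_Nil [simp]: "complete P i [] = []"
  by (simp add: complete_def)

lemma complete_snoc:
  "complete P i (h @ [ib]) =
    complete P i h @ [ib(own_id i \<mapsto> P i (complete P i h) (own_id i))]"
  by (simp add: complete_def)

lemma own_id_input_of [simp]: "own_id (input_of G c \<sigma> v) = v"
  by (simp add: input_of_def)

text \<open>The recomputed message to oneself fills exactly the gap that the model leaves at
  \<open>v\<close>. The induction treats all nodes at once because a new inbox depends on the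
  completed histories of its senders.\<close>

lemma complete_inboxes:
  assumes "v \<in> pverts G"
  shows "complete P (input_of G c \<sigma> v) (inboxes (self_free P D) G c \<sigma> t v) =
    transcript P (pverts G) (input_of G c \<sigma>) t v"
  using assms
proof (induction t arbitrary: v)
  case 0
  then show ?case by simp
next
  case (Suc t)
  let ?H = "transcript P (pverts G) (input_of G c \<sigma>)"
  have send: "send (self_free P D) i h = P i (complete P i h)" for i h
    by (simp add: self_free_def)
  have "(\<lambda>u. if u \<in> pverts G - {v}
          then Some (P (input_of G c \<sigma> u)
            (complete P (input_of G c \<sigma> u) (inboxes (self_free P D) G c \<sigma> t u)) v) else None)
        (v \<mapsto> P (input_of G c \<sigma> v) (?H t v) v) =
      (\<lambda>u. if u \<in> pverts G then Some (P (input_of G c \<sigma> u) (?H t u) v) else None)"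
    using Suc by (auto simp: fun_eq_iff)
  then show ?case
    using Suc by (simp add: complete_snoc send cong: if_cong)
qed

lemma send_self_free:
  assumes "v \<in> pverts G"
  shows "send (self_free P D) (input_of G c \<sigma> v) (inboxes (self_free P D) G c \<sigma> t v) =
    P (input_of G c \<sigma> v) (transcript P (pverts G) (input_of G c \<sigma>) t v)"
  using complete_inboxes[OF assms, of P c \<sigma> D t] by (simp add: self_free_def)

lemma decision_self_free:
  assumes "v \<in> pverts G"
  shows "decision (self_free P D) G c \<sigma> t v =
    D (input_of G c \<sigma> v) (transcript P (pverts G) (input_of G c \<sigma>) t v)"
  using complete_inboxes[OF assms, of P c \<sigma> D t] by (simp add: self_free_def decision_def)


section \<open>Gathering bit strings at all nodes\<close>

text \<open>
  Node \<open>u\<close> holds a bit string of length \<open>l u\<close>. The protocol has three phases. First, every node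
  broadcasts the binary digits of \<open>l u\<close>, one per round, and falls silent; the first round in which all
  are silent ends the phase for everybody. Now all nodes know \<open>l\<close>, hence the position of each bit in
  the concatenation of all strings. In the spreading phase, the bit at position \<open>g\<close> goes to the node of
  rank \<open>g mod n\<close>; a string occupies consecutive positions, so each node sends at most one bit to each
  other node per block of \<open>n\<close> positions. In the relay phase, block \<open>r\<close> is broadcast in round
  \<open>r\<close>, each node contributing the bit that it received.
\<close>

definition length_msg :: "nat \<Rightarrow> nat \<Rightarrow> bool list" where
  "length_msg l s = (if l < 2 ^ s then [] else [bit l s])"

definition quiet :: "inbox list \<Rightarrow> nat \<Rightarrow> bool" where
  "quiet h s \<longleftrightarrow> ran (h ! s) \<subseteq> {[]}"

text \<open>Used only for histories that contain a quiet round, so the junk past their end is harmless.\<close>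

definition first_quiet :: "inbox list \<Rightarrow> nat" where
  "first_quiet h = (LEAST s. quiet h s)"

definition lengths :: "inbox list \<Rightarrow> nat \<Rightarrow> nat" where
  "lengths h u = horner_sum of_bool 2 (map (\<lambda>s. (h ! s) u = Some [True]) [0..<first_quiet h])"

definition offset :: "nat set \<Rightarrow> (nat \<Rightarrow> nat) \<Rightarrow> nat \<Rightarrow> nat" where
  "offset V l u = (\<Sum>w\<in>{w\<in>V. w < u}. l w)"

text \<open>A string that starts in the middle of a block touches up to two blocks more than its
  length divided by \<open>card V\<close>.\<close>

definition spread_rounds :: "nat set \<Rightarrow> (nat \<Rightarrow> nat) \<Rightarrow> nat" where
  "spread_rounds V l = Max (l ` V) div card V + 2"

definition relay_rounds :: "nat set \<Rightarrow> (nat \<Rightarrow> nat) \<Rightarrow> nat" where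
  "relay_rounds V l = (\<Sum>u\<in>V. l u) div card V + 1"

text \<open>Round \<open>r\<close> serves the \<open>r\<close>-th block counted from the one where
  the string of \<open>u\<close> begins, so in the same round different senders work on different
  blocks. Hence the longest string, and not the total length, determines the duration.\<close>

definition spread_msg ::
  "nat set \<Rightarrow> (nat \<Rightarrow> nat) \<Rightarrow> nat \<Rightarrow> bool list \<Rightarrow> nat \<Rightarrow> nat \<Rightarrow> bool list" where
  "spread_msg V l u x r w =
     (let g = (offset V l u div card V + r) * card V + to_nat_on V w
      in if offset V l u \<le> g \<and> g < offset V l u + length x then [x ! (g - offset V l u)] else [])"

text \<open>Only meaningful if position \<open>g\<close> is occupied; past the end, junk is relayed and ignored.\<close>

definition relay_bit :: "nat set \<Rightarrow> (nat \<Rightarrow> nat) \<Rightarrow> inbox list \<Rightarrow> nat \<Rightarrow> nat \<Rightarrow> bool" where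
  "relay_bit V l h k g =
     (let u = THE u. u \<in> V \<and> offset V l u \<le> g \<and> g < offset V l u + l u
      in (h ! (k + (g div card V - offset V l u div card V))) u = Some [True])"

text \<open>Completed histories include the node itself, so \<open>dom (h ! 0)\<close> is the whole
  clique. This set, the lengths and the end of the first phase all come from broadcasts, so the
  nodes switch phases simultaneously.\<close>

definition gather :: "(local_input \<Rightarrow> bool list) \<Rightarrow> local_input \<Rightarrow> inbox list \<Rightarrow> nat \<Rightarrow> bool list" where
  "gather enc i h v =
     (if \<forall>s<length h. \<not> quiet h s then length_msg (length (enc i)) (length h)
      else let V = dom (h ! 0); l = lengths h; k = Suc (first_quiet h); r = length h - k;
               R = spread_rounds V l
           in if r < R then spread_msg V l (own_id i) (enc i) r v
              else [relay_bit V l h k ((r - R) * card V + to_nat_on V (own_id i))])"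

definition gathered :: "inbox list \<Rightarrow> nat \<Rightarrow> bool list" where
  "gathered h u =
     (let V = dom (h ! 0); l = lengths h; k = Suc (first_quiet h) + spread_rounds V l
      in map (\<lambda>j. let g = offset V l u + j
                  in (h ! (k + g div card V)) (from_nat_into V (g mod card V)) = Some [True])
           [0..<l u])"

definition decode_when_gathered ::
  "(nat set \<Rightarrow> (nat \<Rightarrow> bool list) \<Rightarrow> flow_result) \<Rightarrow> local_input \<Rightarrow> inbox list \<Rightarrow> flow_result option"
  where
  "decode_when_gathered R i h =
     (if \<forall>s<length h. \<not> quiet h s then None
      else let V = dom (h ! 0); l = lengths h
           in if length h < Suc (first_quiet h) + spread_rounds V l + relay_rounds V l then None
              else Some (R V (gathered h)))"

lemma gather_early:
  "\<forall>s<length h. \<not> quiet h s \<Longrightarrow> gather enc i h v = length_msg (length (enc i)) (length h)"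
  by (simp add: gather_def)

lemma gather_late:
  assumes "\<not> (\<forall>s<length h. \<not> quiet h s)" "dom (h ! 0) = V" "lengths h = l"
    "Suc (first_quiet h) = k"
  shows "gather enc i h v =
    (let r = length h - k; R = spread_rounds V l
     in if r < R then spread_msg V l (own_id i) (enc i) r v
        else [relay_bit V l h k ((r - R) * card V + to_nat_on V (own_id i))])"
  using assms(1) unfolding gather_def assms(2-4) Let_def by (simp only: if_False)

lemma length_gather: "length (gather enc i h v) \<le> 1"
  by (simp add: gather_def length_msg_def spread_msg_def Let_def)

section \<open>Correctness of the gathering protocol\<close>

locale gathering =
  fixes enc :: "local_input \<Rightarrow> bool list" and V :: "nat set" and I :: "nat \<Rightarrow> local_input"
  assumes finite_nodes: "finite V" and nodes_nonempty: "V \<noteq> {}"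
    and own_id [simp]: "u \<in> V \<Longrightarrow> own_id (I u) = u"
begin

abbreviation H :: "nat \<Rightarrow> nat \<Rightarrow> inbox list" where
  "H \<equiv> transcript (gather enc) V I"

text \<open>With the default \<open>[]\<close> outside \<open>V\<close>, the gathered map equals
  \<open>x\<close> as a total function, so every node passes the same argument to the
  decoder.\<close>

definition x :: "nat \<Rightarrow> bool list" where
  "x u = (if u \<in> V then enc (I u) else [])"

definition l :: "nat \<Rightarrow> nat" where
  "l u = length (x u)"

definition K :: nat where
  "K = (LEAST s. \<forall>u\<in>V. l u < 2 ^ s)"

definition finish :: nat where
  "finish = Suc K + spread_rounds V l + relay_rounds V l"

lemma card_pos: "card V > 0"
  using finite_nodes nodes_nonempty by (simp add: card_gt_0_iff)

lemma K_bound: "\<forall>u\<in>V. l u < 2 ^ K"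
  unfolding K_def
proof (rule LeastI)
  show "\<forall>u\<in>V. l u < 2 ^ Max (l ` V)"
    using finite_nodes by (auto intro!: le_less_trans[OF Max_ge less_exp])
qed

lemma less_K: "s < K \<Longrightarrow> \<exists>u\<in>V. 2 ^ s \<le> l u"
  unfolding K_def by (drule not_less_Least) (auto simp: not_less)

lemma ran_nth_H: "s < t \<Longrightarrow> ran (H t v ! s) = (\<lambda>u. gather enc (I u) (H s u) v) ` V"
  by (auto simp: nth_transcript ran_def)

text \<open>By minimality of \<open>K\<close>, in each round before \<open>t\<close> some length
  still has digits to send; by the induction hypothesis for that round its owner does speak. So
  nobody has seen a quiet round, and all nodes are still in the first phase.\<close>

lemma length_phase: "t \<le> K \<Longrightarrow> u \<in> V \<Longrightarrow> gather enc (I u) (H t u) v = length_msg (l u) t"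
proof (induction t arbitrary: u v rule: less_induct)
  case (less t)
  have "\<not> quiet (H t u) s" if "s < t" for s
  proof -
    obtain w where w: "w \<in> V" "2 ^ s \<le> l w"
      using less_K[of s] less.prems \<open>s < t\<close> by auto
    then have "gather enc (I w) (H s w) u \<noteq> []"
      using less that by (simp add: length_msg_def)
    then show ?thesis
      using w that by (auto simp: quiet_def ran_nth_H)
  qed
  then show ?case
    using less.prems by (simp add: gather_early l_def x_def)
qed

lemma quiet_iff: "s \<le> K \<Longrightarrow> s < t \<Longrightarrow> quiet (H t v) s \<longleftrightarrow> s = K"
  using K_bound less_K[of s]
  by (fastforce simp: quiet_def ran_nth_H length_phase length_msg_def split: if_splits)

lemma first_quiet_H: "K < t \<Longrightarrow> first_quiet (H t v) = K"
  unfolding first_quiet_def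
proof (rule Least_equality)
  show "quiet (H t v) K" if "K < t"
    using that by (simp add: quiet_iff)
  show "K \<le> s" if "K < t" "quiet (H t v) s" for s
    using that quiet_iff[of s t v] by (cases "s < K") auto
qed

lemma not_quiet_iff: "(\<forall>s<t. \<not> quiet (H t v) s) \<longleftrightarrow> t \<le> K"
proof (cases "t \<le> K")
  case True
  then show ?thesis by (auto simp: quiet_iff)
next
  case False
  then have "K < t" by simp
  moreover from this have "quiet (H t v) K" by (simp add: quiet_iff)
  ultimately show ?thesis by (meson leD)
qed

lemma dom_nth_H: "s < t \<Longrightarrow> dom (H t v ! s) = V"
  by (auto simp: nth_transcript dom_def)

lemma lengths_H: "K < t \<Longrightarrow> lengths (H t v) = l"
proof
  fix u
  assume t: "K < t"
  have "((H t v ! s) u = Some [True]) = bit (l u) s" if "s < K" for s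
  proof (cases "u \<in> V")
    case True
    then have "(H t v ! s) u = Some (length_msg (l u) s)"
      using that t by (simp add: nth_transcript length_phase)
    \<comment> \<open>A node is silent only when its remaining digits are all 0, so reading silence
      as the digit 0 is correct.\<close>
    moreover have "bit (l u) s \<Longrightarrow> \<not> l u < 2 ^ s"
      by (auto simp: bit_iff_odd)
    ultimately show ?thesis
      by (auto simp: length_msg_def)
  next
    case False
    then show ?thesis
      using that t by (simp add: nth_transcript l_def x_def)
  qed
  then have "lengths (H t v) u = horner_sum of_bool 2 (map (bit (l u)) [0..<K])"
    unfolding lengths_def first_quiet_H[OF t] by (intro arg_cong2[where f = "horner_sum of_bool"] map_cong) auto
  also have "\<dots> = take_bit K (l u)"
    by (rule horner_sum_bit_eq_take_bit)
  also have "\<dots> = l u"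
    using K_bound by (cases "u \<in> V") (auto simp: take_bit_nat_eq_self l_def x_def)
  finally show "lengths (H t v) u = l u" .
qed

lemma gather_late_H:
  assumes "K < t"
  shows "gather e i (H t u) w =
    (let r = t - Suc K; R = spread_rounds V l
     in if r < R then spread_msg V l (own_id i) (e i) r w
        else [relay_bit V l (H t u) (Suc K) ((r - R) * card V + to_nat_on V (own_id i))])"
  using assms not_quiet_iff[of t u] gather_late[of "H t u" V l "Suc K"]
  by (simp add: first_quiet_H lengths_H dom_nth_H)

lemma gather_spread:
  assumes "u \<in> V" "r < spread_rounds V l"
  shows "gather enc (I u) (H (Suc K + r) u) w = spread_msg V l u (x u) r w"
  using assms gather_late_H[of "Suc K + r" enc "I u" u w] by (simp add: x_def)

lemma gather_relay:
  assumes "u \<in> V"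
  shows "gather enc (I u) (H (Suc K + spread_rounds V l + r) u) w =
    [relay_bit V l (H (Suc K + spread_rounds V l + r) u) (Suc K) (r * card V + to_nat_on V u)]"
  using assms gather_late_H[of "Suc K + spread_rounds V l + r" enc "I u" u w]
  by (simp add: Let_def del: transcript.simps)

lemma offset_mono:
  assumes "u \<in> V" "u < w"
  shows "offset V l u + l u \<le> offset V l w"
proof -
  have "offset V l u + l u = (\<Sum>w\<in>insert u {w\<in>V. w < u}. l w)"
    using finite_nodes by (simp add: offset_def)
  also have "\<dots> \<le> offset V l w"
    unfolding offset_def using assms finite_nodes by (intro sum_mono2) auto
  finally show ?thesis .
qed

lemma offset_total:
  assumes "u \<in> V"
  shows "offset V l u + l u \<le> (\<Sum>w\<in>V. l w)"
proof -
  have "offset V l u + l u = (\<Sum>w\<in>insert u {w\<in>V. w < u}. l w)"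
    using finite_nodes by (simp add: offset_def)
  also have "\<dots> \<le> (\<Sum>w\<in>V. l w)"
    using assms finite_nodes by (intro sum_mono2) auto
  finally show ?thesis .
qed

text \<open>Of two strings, the one with the smaller identifier ends before the other begins, so the
  definite description in \<open>relay_bit\<close> has a unique witness.\<close>

lemma owner_eq:
  assumes "u \<in> V" "offset V l u \<le> g" "g < offset V l u + l u"
  shows "(THE u. u \<in> V \<and> offset V l u \<le> g \<and> g < offset V l u + l u) = u"
proof (rule the_equality)
  fix w
  assume "w \<in> V \<and> offset V l w \<le> g \<and> g < offset V l w + l w"
  then show "w = u"
    using assms offset_mono[of u w] offset_mono[of w u] by (cases u w rule: linorder_cases) auto
qed (use assms in auto)

text \<open>Follows one bit through the spreading phase: its block, counted from the first block of
  its owner, is the round in which the node of the matching rank receives it, and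
  \<open>relay_bit\<close> looks into that inbox.\<close>

lemma relay_bit_H:
  assumes "u \<in> V" "j < l u" "Suc K + spread_rounds V l \<le> t" "v \<in> V"
    and g: "g = offset V l u + j" and v: "to_nat_on V v = g mod card V"
  shows "relay_bit V l (H t v) (Suc K) g = x u ! j"
proof -
  let ?n = "card V"
  define r where "r = g div ?n - offset V l u div ?n"
  have le: "offset V l u div ?n \<le> g div ?n"
    by (simp add: g div_le_mono)
  have "l u \<le> Max (l ` V)"
    using assms(1) finite_nodes by simp
  then have "g div ?n \<le> (offset V l u + Max (l ` V)) div ?n"
    using assms(2) by (intro div_le_mono) (simp add: g)
  also have "\<dots> \<le> offset V l u div ?n + Max (l ` V) div ?n + 1"
  proof -
    \<comment> \<open>Adding the two remainders gives at most one carry; this and the strict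
      inequality for \<open>r\<close> make up the \<open>+ 2\<close> in
      \<open>spread_rounds\<close>.\<close>
    have "offset V l u mod ?n + Max (l ` V) mod ?n < ?n + ?n"
      using card_pos by (intro add_strict_mono) simp_all
    then have "(offset V l u mod ?n + Max (l ` V) mod ?n) div ?n \<le> 1"
      by (simp add: less_Suc_eq_le[symmetric] div_less_iff_less_mult card_pos)
    then show ?thesis
      by (subst div_add1_eq) simp
  qed
  finally have r: "r < spread_rounds V l"
    by (simp add: r_def spread_rounds_def)
  have "(offset V l u div ?n + r) * ?n + to_nat_on V v = g"
    using le by (simp add: r_def v)
  then have "spread_msg V l u (x u) r v = [x u ! j]"
    using assms(2) by (simp add: spread_msg_def g Let_def l_def)
  then have "(H t v ! (Suc K + r)) u = Some [x u ! j]"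
    using r assms gather_spread[of u r v] by (simp add: nth_transcript del: transcript.simps)
  moreover have "(THE u. u \<in> V \<and> offset V l u \<le> g \<and> g < offset V l u + l u) = u"
    using assms by (intro owner_eq) auto
  ultimately show ?thesis
    by (simp add: relay_bit_def Let_def r_def)
qed

text \<open>Every occupied position lies in a block that has been relayed by round
  \<open>finish\<close>, and its relaying node is the one to which the spreading phase delivered the
  bit.\<close>

lemma gathered_H:
  assumes "t \<ge> finish"
  shows "gathered (H t v) = x"
proof
  fix u
  have t: "K < t"
    using assms by (simp add: finish_def)
  let ?n = "card V" and ?k = "Suc K + spread_rounds V l"
  have "(H t v ! (?k + g div ?n)) (from_nat_into V (g mod ?n)) = Some [x u ! j]"
    if g: "g = offset V l u + j" and j: "j < l u" for g j
  proof -
    have u: "u \<in> V"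
      using j by (auto simp: l_def x_def split: if_splits)
    define w where "w = from_nat_into V (g mod ?n)"
    have w: "w \<in> V"
      using nodes_nonempty by (simp add: w_def from_nat_into)
    have rank: "to_nat_on V w = g mod ?n"
      using bij_betw_imp_surj_on[OF to_nat_on_finite[OF finite_nodes]] card_pos
      by (simp add: w_def)
    have "g div ?n < relay_rounds V l"
      using offset_total[OF u] j by (simp add: g relay_rounds_def less_Suc_eq_le div_le_mono)
    then have "(H t v ! (?k + g div ?n)) w = Some (gather enc (I w) (H (?k + g div ?n) w) v)"
      using assms w by (simp add: nth_transcript finish_def del: transcript.simps)
    also have "\<dots> = Some [x u ! j]"
      unfolding gather_relay[OF w]
      using relay_bit_H[OF u j _ w g rank, of "?k + g div ?n"] by (simp add: rank)
    finally show ?thesis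
      by (simp add: w_def)
  qed
  then have "gathered (H t v) u = map (\<lambda>j. x u ! j) [0..<l u]"
    using t by (simp add: gathered_def lengths_H first_quiet_H dom_nth_H Let_def)
  then show "gathered (H t v) u = x u"
    by (simp add: l_def map_nth)
qed

lemma decode_H:
  "decode_when_gathered R i (H t v) = (if t < finish then None else Some (R V x))"
proof (cases "t \<le> K")
  case True
  then show ?thesis
    using not_quiet_iff[of t v] by (simp add: decode_when_gathered_def finish_def)
next
  case False
  then show ?thesis
    using not_quiet_iff[of t v] gathered_H[of t v]
    by (auto simp: decode_when_gathered_def finish_def Let_def first_quiet_H lengths_H dom_nth_H)
qed

end


section \<open>Encoding the input of a node\<close>

text \<open>A self-delimiting binary code: each digit, least significant first, follows a flag
  \<open>True\<close>, and \<open>False\<close> ends the number. This only doubles the length, up to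
  a constant.\<close>

fun nat_code :: "nat \<Rightarrow> bool list" where
  "nat_code k = (if k = 0 then [False] else True # odd k # nat_code (k div 2))"

declare nat_code.simps [simp del]

lemma nat_code_append_eqD:
  "nat_code a @ xs = nat_code b @ ys \<Longrightarrow> a = b \<and> xs = ys"
proof (induction a arbitrary: b rule: nat_code.induct)
  case (1 a)
  show ?case
  proof (cases "a = 0 \<or> b = 0")
    case True
    then show ?thesis
      using "1.prems" by (auto simp: nat_code.simps[of a] nat_code.simps[of b] split: if_splits)
  next
    case False
    then have "odd a = odd b" "nat_code (a div 2) @ xs = nat_code (b div 2) @ ys"
      using "1.prems" by (auto simp: nat_code.simps[of a] nat_code.simps[of b])
    then show ?thesis
      using "1.IH"[of "b div 2"] False by (metis bit_eq_rec)
  qed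
qed

lemma nat_code_neq_Nil [simp]: "nat_code k \<noteq> []"
  by (subst nat_code.simps) simp

lemma concat_nat_code_inject: "concat (map nat_code xs) = concat (map nat_code ys) \<Longrightarrow> xs = ys"
proof (induction xs arbitrary: ys)
  case Nil
  then show ?case by (cases ys) auto
next
  case (Cons k xs)
  then show ?case by (cases ys) (auto dest: nat_code_append_eqD)
qed

text \<open>Halving shortens the code by two and lowers the logarithm by at least one. The constant
  3 is the length of the code of 1.\<close>

lemma length_nat_code_pos: "0 < k \<Longrightarrow> real (length (nat_code k)) \<le> 2 * log 2 (real k) + 3"
proof (induction k rule: nat_code.induct)
  case (1 k)
  show ?case
  proof (cases "k = 1")
    case True
    then show ?thesis by (simp add: nat_code.simps)
  next
    case False
    then have "0 < k div 2" using 1(2) by (simp add: div_greater_zero_iff)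
    then have "real (length (nat_code (k div 2))) \<le> 2 * log 2 (real (k div 2)) + 3"
      using 1 by simp
    also have "log 2 (real (k div 2)) \<le> log 2 (real k / 2)"
      using \<open>0 < k div 2\<close> of_nat_div_le_of_nat[of k 2, where 'a = real] by simp
    also have "\<dots> = log 2 (real k) - 1"
      using 1(2) by (simp add: log_divide)
    finally show ?thesis
      using 1(2) by (subst nat_code.simps) simp
  qed
qed

lemma length_nat_code: "real (length (nat_code k)) \<le> 2 * log 2 (real k + 1) + 3"
proof (cases "k = 0")
  case True
  then show ?thesis by (simp add: nat_code.simps)
next
  case False
  then have "log 2 (real k) \<le> log 2 (real k + 1)" by simp
  then show ?thesis using length_nat_code_pos[of k] False by linarith
qed

text \<open>Each arc is recorded by its tail alone, so all strings together hold one code per arc.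
  The tail is implicit as the identifier of the holder.\<close>

definition out_codes :: "local_input \<Rightarrow> nat set" where
  "out_codes i = (\<lambda>(e, k). prod_encode (snd e, k)) ` {p \<in> own_edges i. fst (fst p) = own_id i}"

text \<open>A demand larger than the number of incident edges can never be met, whatever its value.\<close>

definition demand_code :: "local_input \<Rightarrow> nat" where
  "demand_code i = (if \<bar>own_demand i\<bar> \<le> int (card (own_edges i))
     then Suc (int_encode (own_demand i)) else 0)"

definition encoding :: "local_input \<Rightarrow> bool list" where
  "encoding i = concat (map nat_code (demand_code i # sorted_list_of_set (out_codes i)))"

lemma finite_incident_arcs: "finite (parcs G) \<Longrightarrow> finite (incident_arcs G v)"
  by (simp add: incident_arcs_def in_arcs_def out_arcs_def)

lemma card_own_edges: "card (own_edges (input_of G c \<sigma> v)) = card (incident_arcs G v)"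
  by (simp add: input_of_def card_image inj_on_def)

lemma own_demand_input_of [simp]: "own_demand (input_of G c \<sigma> v) = \<sigma> v"
  by (simp add: input_of_def)

lemma out_codes_input_of:
  "out_codes (input_of G c \<sigma> v) = (\<lambda>e. prod_encode (snd e, c e)) ` out_arcs G v"
  by (auto simp: out_codes_def input_of_def incident_arcs_def out_arcs_def image_iff)

lemma encoding_eqD:
  assumes "encoding (input_of G c \<sigma> v) = encoding (input_of G' c' \<sigma>' v)"
    and fin: "finite (parcs G)" "finite (parcs G')"
  shows "demand_code (input_of G c \<sigma> v) = demand_code (input_of G' c' \<sigma>' v)"
    and "out_codes (input_of G c \<sigma> v) = out_codes (input_of G' c' \<sigma>' v)"
proof -
  have *: "demand_code (input_of G c \<sigma> v) # sorted_list_of_set (out_codes (input_of G c \<sigma> v)) =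
    demand_code (input_of G' c' \<sigma>' v) # sorted_list_of_set (out_codes (input_of G' c' \<sigma>' v))"
    using assms(1) unfolding encoding_def by (rule concat_nat_code_inject)
  then show "demand_code (input_of G c \<sigma> v) = demand_code (input_of G' c' \<sigma>' v)"
    by simp
  have "finite (out_codes (input_of G c \<sigma> v))" "finite (out_codes (input_of G' c' \<sigma>' v))"
    using fin by (simp_all add: out_codes_input_of out_arcs_def)
  then show "out_codes (input_of G c \<sigma> v) = out_codes (input_of G' c' \<sigma>' v)"
    using * by (metis list.inject set_sorted_list_of_set)
qed

text \<open>With unit capacities, inflow and outflow both lie between 0 and the number of incident
  arcs, hence so does the absolute value of their difference. This justifies the cutoff in
  \<open>demand_code\<close>.\<close>

lemma feasible_demand_le:
  assumes "feasible_flow G \<sigma> f" "finite (parcs G)" "v \<in> pverts G"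
  shows "\<bar>\<sigma> v\<bar> \<le> int (card (incident_arcs G v))"
proof -
  have bounds: "0 \<le> sum f S \<and> sum f S \<le> real (card (incident_arcs G v))"
    if "S \<subseteq> incident_arcs G v" for S
  proof -
    have f: "0 \<le> f e \<and> f e \<le> 1" if "e \<in> S" for e
      using assms(1) that \<open>S \<subseteq> incident_arcs G v\<close>
      by (auto simp: feasible_flow_def incident_arcs_def in_arcs_def out_arcs_def)
    have "sum f S \<le> real (card S)"
      using f sum_bounded_above[of S f 1] by simp
    moreover have "card S \<le> card (incident_arcs G v)"
      using that assms(2) by (intro card_mono finite_incident_arcs)
    ultimately show ?thesis
      using f by (auto intro: sum_nonneg)
  qed
  have "sum f (out_arcs G v) - sum f (in_arcs G v) = of_int (\<sigma> v)"
    using assms(1,3) by (simp add: feasible_flow_def)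
  then have "\<bar>real_of_int (\<sigma> v)\<bar> \<le> real (card (incident_arcs G v))"
    using bounds[of "out_arcs G v"] bounds[of "in_arcs G v"] by (auto simp: incident_arcs_def)
  then show ?thesis by linarith
qed

text \<open>Instances that cannot be told apart after gathering. They may still differ in costs off
  the arcs and in demands beyond the cutoff.\<close>

definition same_encoding ::
  "nat pair_pre_digraph \<Rightarrow> (nat \<times> nat \<Rightarrow> nat) \<Rightarrow> (nat \<Rightarrow> int) \<Rightarrow>
   nat pair_pre_digraph \<Rightarrow> (nat \<times> nat \<Rightarrow> nat) \<Rightarrow> (nat \<Rightarrow> int) \<Rightarrow> bool" where
  "same_encoding G c \<sigma> G' c' \<sigma>' \<longleftrightarrow>
     pair_fin_digraph G \<and> pair_fin_digraph G' \<and> pverts G = pverts G' \<and>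
     (\<forall>u\<in>pverts G. encoding (input_of G c \<sigma> u) = encoding (input_of G' c' \<sigma>' u))"

lemma same_encoding_sym: "same_encoding G c \<sigma> G' c' \<sigma>' \<Longrightarrow> same_encoding G' c' \<sigma>' G c \<sigma>"
  by (auto simp: same_encoding_def)

lemma same_encoding_arcs_subset:
  assumes "same_encoding G c \<sigma> G' c' \<sigma>'" "e \<in> parcs G"
  shows "e \<in> parcs G' \<and> c e = c' e"
proof -
  interpret G: pair_fin_digraph G using assms by (simp add: same_encoding_def)
  interpret G': pair_fin_digraph G' using assms by (simp add: same_encoding_def)
  have "fst e \<in> pverts G"
    using assms(2) by (rule G.arc_fst_in_verts)
  then have "out_codes (input_of G c \<sigma> (fst e)) = out_codes (input_of G' c' \<sigma>' (fst e))"
    using assms(1) G.pair_finite_arcs G'.pair_finite_arcs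
    by (intro encoding_eqD(2)) (auto simp: same_encoding_def)
  moreover have "prod_encode (snd e, c e) \<in> out_codes (input_of G c \<sigma> (fst e))"
    using assms(2) by (auto simp: out_codes_input_of out_arcs_def)
  ultimately show ?thesis
    by (auto simp: out_codes_input_of out_arcs_def prod_eq_iff)
qed

lemma same_encoding_arcs: "same_encoding G c \<sigma> G' c' \<sigma>' \<Longrightarrow> parcs G = parcs G'"
  using same_encoding_arcs_subset same_encoding_sym by blast

text \<open>Feasibility keeps the demands of the first instance within the cutoff, so none has code
  0; equality of codes then forces the demands of the second instance to be the same.\<close>

lemma same_encoding_feasible:
  assumes "same_encoding G c \<sigma> G' c' \<sigma>'" "feasible_flow G \<sigma> f"
  shows "feasible_flow G' \<sigma>' f"
proof -
  have arcs: "parcs G = parcs G'"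
    using assms(1) by (rule same_encoding_arcs)
  have fin: "finite (parcs G)" and verts: "pverts G' = pverts G"
    using assms(1) by (auto simp: same_encoding_def pair_fin_digraph.pair_finite_arcs)
  have sets: "in_arcs G' v = in_arcs G v" "out_arcs G' v = out_arcs G v" for v
    by (simp_all add: in_arcs_def out_arcs_def arcs)
  have "\<sigma>' v = \<sigma> v" if "v \<in> pverts G" for v
  proof -
    have "demand_code (input_of G c \<sigma> v) = demand_code (input_of G' c' \<sigma>' v)"
      using assms(1) fin that arcs
      by (intro encoding_eqD(1)) (auto simp: same_encoding_def)
    moreover have "\<bar>\<sigma> v\<bar> \<le> int (card (incident_arcs G v))"
      using assms(2) fin that by (rule feasible_demand_le)
    ultimately have "int_encode (\<sigma> v) = int_encode (\<sigma>' v)"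
      by (simp add: demand_code_def card_own_edges split: if_splits)
    then show ?thesis
      using inj_int_encode[of UNIV] by (simp add: inj_on_def)
  qed
  then show ?thesis
    using assms(2) by (simp add: feasible_flow_def arcs sets verts)
qed

lemma same_encoding_feasible_iff:
  "same_encoding G c \<sigma> G' c' \<sigma>' \<Longrightarrow> feasible_flow G \<sigma> f \<longleftrightarrow> feasible_flow G' \<sigma>' f"
  using same_encoding_feasible same_encoding_sym by blast

lemma same_encoding_min_cost_flow_iff:
  assumes "same_encoding G c \<sigma> G' c' \<sigma>'"
  shows "min_cost_flow G c \<sigma> f \<longleftrightarrow> min_cost_flow G' c' \<sigma>' f"
proof -
  have "flow_cost G c g = flow_cost G' c' g" for g
    unfolding flow_cost_def same_encoding_arcs[OF assms]
    using same_encoding_arcs_subset[OF same_encoding_sym[OF assms]] by (intro sum.cong) auto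
  then show ?thesis
    by (simp add: min_cost_flow_def same_encoding_feasible_iff[OF assms])
qed


section \<open>Existence of an optimal flow\<close>

text \<open>Values off the arcs are unconstrained, so the set of all feasible flows need not be
  compact. Resetting them to 0 changes neither feasibility nor cost and leads into a box that is
  compact by Tychonoff; the continuous cost attains its minimum there.\<close>

lemma min_cost_flow_exists:
  fixes G :: "'v pair_pre_digraph"
  assumes feasible: "feasible_flow G \<sigma> f0"
  shows "\<exists>f. min_cost_flow G c \<sigma> f"
proof -
  define cut :: "('v \<times> 'v \<Rightarrow> real) \<Rightarrow> 'v \<times> 'v \<Rightarrow> real"
    where "cut f = (\<lambda>e. if e \<in> parcs G then f e else 0)" for f
  have cut_feasible: "feasible_flow G \<sigma> (cut f) \<longleftrightarrow> feasible_flow G \<sigma> f" for f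
  proof -
    have "sum (cut f) (out_arcs G v) = sum f (out_arcs G v)"
      "sum (cut f) (in_arcs G v) = sum f (in_arcs G v)" for v
      by (auto intro!: sum.cong simp: cut_def in_arcs_def out_arcs_def)
    then show ?thesis by (simp add: feasible_flow_def cut_def)
  qed
  have cut_cost: "flow_cost G c (cut f) = flow_cost G c f" for f
    by (auto intro!: sum.cong simp: cut_def flow_cost_def)
  define box where "box = PiE UNIV (\<lambda>e. if e \<in> parcs G then {0..1::real} else {0})"
  define S where "S = box \<inter> (\<Inter>v\<in>pverts G.
    {f. (\<Sum>e\<in>out_arcs G v. f e) - (\<Sum>e\<in>in_arcs G v. f e) = of_int (\<sigma> v)})"
  have cut_S: "cut f \<in> S" if "feasible_flow G \<sigma> f" for f
    using that unfolding cut_feasible[of f, symmetric]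
    by (auto simp: S_def box_def feasible_flow_def) (auto simp: cut_def)
  have S_feasible: "feasible_flow G \<sigma> f" if "f \<in> S" for f
    using that by (auto simp: S_def box_def feasible_flow_def PiE_iff split: if_splits)
  have "compactin (product_topology (\<lambda>e. euclidean) UNIV) box"
    unfolding box_def compactin_PiE by (auto simp: compactin_euclidean_iff)
  then have "compact box"
    by (simp add: euclidean_product_topology compactin_euclidean_iff)
  then have "compact S"
    unfolding S_def
    by (intro compact_Int_closed closed_INT ballI closed_Collect_eq continuous_intros
        continuous_on_product_coordinates)
  moreover have "S \<noteq> {}"
    using cut_S[OF feasible] by auto
  moreover have "continuous_on S (flow_cost G c)"
    unfolding flow_cost_def
    by (intro continuous_intros continuous_on_subset[OF continuous_on_product_coordinates]) auto
  ultimately obtain f where f: "f \<in> S" "\<And>g. g \<in> S \<Longrightarrow> flow_cost G c f \<le> flow_cost G c g"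
    using continuous_attains_inf[of S "flow_cost G c"] by auto
  have "flow_cost G c f \<le> flow_cost G c g" if "feasible_flow G \<sigma> g" for g
    using f(2)[OF cut_S[OF that]] by (simp add: cut_cost)
  then show ?thesis
    using S_feasible[OF f(1)] by (auto simp: min_cost_flow_def)
qed

text \<open>Both choices depend on \<open>V\<close> and \<open>x\<close> alone, so all nodes choose
  the same instance and the same optimal flow, even if there are several optima.\<close>

definition solve :: "nat set \<Rightarrow> (nat \<Rightarrow> bool list) \<Rightarrow> flow_result" where
  "solve V x =
     (case SOME (G, c, \<sigma>). pair_fin_digraph G \<and> pverts G = V \<and>
         (\<forall>u\<in>V. encoding (input_of G c \<sigma> u) = x u)
      of (G, c, \<sigma>) \<Rightarrow>
        if \<exists>f. feasible_flow G \<sigma> f then Flow (SOME f. min_cost_flow G c \<sigma> f) else Infeasible)"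

text \<open>The chosen instance need not be the actual one, but it has the same encoding and
  therefore the same feasible and optimal flows.\<close>

lemma solve_correct:
  assumes "pair_fin_digraph G" "pverts G = V" "\<And>u. u \<in> V \<Longrightarrow> x u = encoding (input_of G c \<sigma> u)"
  shows "if \<exists>f. feasible_flow G \<sigma> f then \<exists>f. solve V x = Flow f \<and> min_cost_flow G c \<sigma> f
    else solve V x = Infeasible"
proof -
  let ?P = "\<lambda>(G, c, \<sigma>). pair_fin_digraph G \<and> pverts G = V \<and>
    (\<forall>u\<in>V. encoding (input_of G c \<sigma> u) = x u)"
  obtain G' c' \<sigma>' where some: "Eps ?P = (G', c', \<sigma>')"
    by (cases "Eps ?P")
  have "?P (G, c, \<sigma>)"
    using assms by simp
  then have "?P (Eps ?P)"
    by (rule someI)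
  then have "?P (G', c', \<sigma>')"
    unfolding some .
  then have same: "same_encoding G' c' \<sigma>' G c \<sigma>"
    using assms by (simp add: same_encoding_def)
  have solve: "solve V x = (if \<exists>f. feasible_flow G' \<sigma>' f
      then Flow (SOME f. min_cost_flow G' c' \<sigma>' f) else Infeasible)"
    unfolding solve_def some by simp
  show ?thesis
  proof (cases "\<exists>f. feasible_flow G \<sigma> f")
    case True
    then obtain f where "feasible_flow G \<sigma> f" by blast
    then have "\<exists>f. min_cost_flow G c \<sigma> f" by (rule min_cost_flow_exists)
    then have "min_cost_flow G' c' \<sigma>' (SOME f. min_cost_flow G' c' \<sigma>' f)"
      unfolding same_encoding_min_cost_flow_iff[OF same, symmetric] by (rule someI_ex)
    then show ?thesis
      using True
      by (simp add: solve flip: same_encoding_feasible_iff[OF same]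
          same_encoding_min_cost_flow_iff[OF same])
  next
    case False
    then show ?thesis
      by (simp add: solve same_encoding_feasible_iff[OF same])
  qed
qed


section \<open>Duration of the gathering protocol\<close>

context gathering
begin

text \<open>Some node still speaks in round \<open>K - 1\<close>, so some length is at least
  \<open>2 ^ (K - 1)\<close>. The 5 collects 1 for the quiet round, 1 from rounding
  \<open>K\<close>, 2 from spreading and 1 from relaying.\<close>

lemma finish_bound:
  assumes L: "\<And>u. u \<in> V \<Longrightarrow> real (l u) \<le> L" "1 \<le> L" and N: "real (\<Sum>u\<in>V. l u) \<le> N"
  shows "real finish \<le> 5 + log 2 L + (L + N) / real (card V)"
proof -
  have "real K \<le> 1 + log 2 L"
  proof (cases K)
    case 0
    then show ?thesis using L(2) by simp
  next
    case (Suc s)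
    then obtain u where "u \<in> V" "2 ^ s \<le> l u"
      using less_K[of s] by auto
    then have "real (2 ^ s) \<le> L"
      using L(1)[of u] of_nat_mono[of "2 ^ s" "l u", where 'a = real] by linarith
    then have "2 powr real s \<le> L"
      by (simp add: powr_realpow)
    then have "real s \<le> log 2 L"
      using L(2) by (simp add: le_log_iff)
    then show ?thesis using Suc by simp
  qed
  moreover have "real (spread_rounds V l) \<le> L / real (card V) + 2"
  proof -
    have "Max (l ` V) \<in> l ` V"
      using finite_nodes nodes_nonempty by (intro Max_in) auto
    then have "real (Max (l ` V)) \<le> L"
      using L(1) by auto
    moreover have "real (Max (l ` V) div card V) \<le> real (Max (l ` V)) / real (card V)"
      by (rule of_nat_div_le_of_nat)
    ultimately show ?thesis
      unfolding spread_rounds_def using divide_right_mono[of "real (Max (l ` V))" L "real (card V)"]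
      by simp
  qed
  moreover have "real (relay_rounds V l) \<le> N / real (card V) + 1"
  proof -
    have "real ((\<Sum>u\<in>V. l u) div card V) \<le> real (\<Sum>u\<in>V. l u) / real (card V)"
      by (rule of_nat_div_le_of_nat)
    then show ?thesis
      unfolding relay_rounds_def using divide_right_mono[OF N, of "real (card V)"] by simp
  qed
  ultimately show ?thesis
    by (simp add: finish_def add_divide_distrib)
qed

end

definition gather_and_solve :: cc_algorithm where
  "gather_and_solve = self_free (gather encoding) (decode_when_gathered solve)"

lemma gather_and_solve_correct:
  assumes G: "pair_fin_digraph G" "pverts G \<noteq> {}"
  shows "solves_min_cost_flow 1 gather_and_solve G c \<sigma>
    (gathering.finish encoding (pverts G) (input_of G c \<sigma>))"
proof -
  interpret pair_fin_digraph G by fact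
  interpret gathering encoding "pverts G" "input_of G c \<sigma>"
    using G(2) pair_finite_verts by unfold_locales auto
  \<comment> \<open>A recipient other than the sender forces at least two nodes, so one-bit messages
    fit with constant 1. In a clique of one node the logarithm is 0, but nothing is sent.\<close>
  have "1 \<le> log 2 (real (card (pverts G)))" if "u \<in> pverts G" "v \<in> pverts G - {u}" for u v
  proof -
    have "card {u, v} \<le> card (pverts G)"
      using that pair_finite_verts by (intro card_mono) auto
    then show ?thesis
      using that by (subst le_log_iff) auto
  qed
  moreover have "real (length (gather encoding i h v)) \<le> 1" for i h v
    using length_gather[of encoding i h v] by simp
  ultimately have "real (length (gather encoding i h v)) \<le> 1 * log 2 (real (card (pverts G)))"
    if "u \<in> pverts G" "v \<in> pverts G - {u}" for u v i h
    using that by (metis mult_1 order_trans)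
  then have bandwidth: "respects_bandwidth 1 gather_and_solve G c \<sigma> finish"
    unfolding respects_bandwidth_def gather_and_solve_def by (simp add: send_self_free)
  have outputs: "has_output gather_and_solve G c \<sigma> finish v (solve (pverts G) x)"
    if "v \<in> pverts G" for v
    unfolding has_output_def gather_and_solve_def decision_self_free[OF that] decode_H
    by (intro exI[of _ finish]) simp
  have solve: "if \<exists>f. feasible_flow G \<sigma> f
    then \<exists>f. solve (pverts G) x = Flow f \<and> min_cost_flow G c \<sigma> f
    else solve (pverts G) x = Infeasible"
    using G(1) by (intro solve_correct) (auto simp: x_def)
  show ?thesis
  proof (cases "\<exists>f. feasible_flow G \<sigma> f")
    case True
    then obtain f where "solve (pverts G) x = Flow f" "min_cost_flow G c \<sigma> f"
      using solve by auto
    then show ?thesis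
      unfolding solves_min_cost_flow_def using True bandwidth outputs by fastforce
  next
    case False
    then show ?thesis
      unfolding solves_min_cost_flow_def using solve bandwidth outputs by auto
  qed
qed


section \<open>The number of rounds\<close>

lemma prod_encode_bound: "prod_encode (v, k) + 1 \<le> (v + k + 1)\<^sup>2"
proof -
  have "triangle (v + k) \<le> (v + k) * Suc (v + k)"
    by (simp add: triangle_def)
  then show ?thesis
    by (simp add: prod_encode_def power2_eq_square algebra_simps)
qed

lemma int_encode_bound: "int (int_encode s) \<le> 2 * \<bar>s\<bar>"
  by (simp add: int_encode_def sum_encode_def)

lemma length_concat_map_le:
  assumes "\<And>k. k \<in> set ks \<Longrightarrow> real (length (f k)) \<le> B"
  shows "real (length (concat (map f ks))) \<le> real (length ks) * B"
  using assms by (induction ks) (force simp: algebra_simps)+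

lemma add_le_one_add_mult:
  fixes a b :: real
  assumes "1 \<le> a" "1 \<le> b"
  shows "a + b \<le> 1 + a * b"
proof -
  have "0 \<le> (a - 1) * (b - 1)" using assms by simp
  then show ?thesis by (simp add: algebra_simps)
qed

lemma log_2_4: "log 2 4 = (2 :: real)"
  using log_pow_cancel[of "2 :: real" 2] by simp

section \<open>Size of the encoded instance\<close>

locale instance_bounds =
  fixes G :: "nat pair_pre_digraph" and c :: "nat \<times> nat \<Rightarrow> nat" and \<sigma> :: "nat \<Rightarrow> int"
    and a n m W :: nat
  assumes digraph: "pair_fin_digraph G"
    and n: "n = card (pverts G)" and m: "m = card (parcs G)" and n_pos: "1 \<le> n" and W_pos: "1 \<le> W"
    and ids: "\<And>v. v \<in> pverts G \<Longrightarrow> v < n ^ a"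
    and costs: "\<And>e. e \<in> parcs G \<Longrightarrow> c e \<in> {1..W}"
begin

text \<open>The shifts by one here and in \<open>\<omega>\<close> keep both quantities at least 1
  even for \<open>n = 1\<close> or \<open>W = 1\<close>, so that sums can be absorbed into
  products.\<close>

definition \<kappa> :: real where "\<kappa> = log 2 (real n + 1)"

definition \<omega> :: real where "\<omega> = 1 + log 2 (real W)"

text \<open>Bounds the code of any single number sent. Arc codes need \<open>4 * a + 7\<close>; the
  9 covers demand codes, whose length is at most \<open>2 * (2 + \<kappa>) + 3\<close>.\<close>

definition B :: real where "B = (4 * real a + 9) * \<kappa> * \<omega>"

lemma \<kappa>_ge_1: "1 \<le> \<kappa>"
  unfolding \<kappa>_def using n_pos by (subst le_log_iff) auto

lemma \<omega>_ge_1: "1 \<le> \<omega>"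
  unfolding \<omega>_def using W_pos by simp

lemma \<kappa>_\<omega>_ge: "\<kappa> \<le> \<kappa> * \<omega>" "\<omega> \<le> \<kappa> * \<omega>" "1 \<le> \<kappa> * \<omega>"
  using \<kappa>_ge_1 \<omega>_ge_1 by (simp_all add: mult_le_cancel_left1 mult_le_cancel_right1 mult_ge1_I)

lemma B_ge: "9 * \<kappa> \<le> B"
proof -
  have "9 * \<kappa> \<le> 9 * (\<kappa> * \<omega>)" using \<kappa>_\<omega>_ge(1) by simp
  also have "\<dots> \<le> (4 * real a + 9) * (\<kappa> * \<omega>)"
    using \<kappa>_\<omega>_ge(3) by (intro mult_right_mono) auto
  finally show ?thesis by (simp add: B_def)
qed

lemma fin: "finite (pverts G)" "finite (parcs G)"
  using digraph by (simp_all add: pair_fin_digraph.pair_finite_verts pair_fin_digraph.pair_finite_arcs)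

lemma arcs_subset: "parcs G \<subseteq> pverts G \<times> pverts G"
proof -
  interpret pair_fin_digraph G by (rule digraph)
  show ?thesis using arc_fst_in_verts arc_snd_in_verts by fastforce
qed

lemma card_out_arcs_le: "card (out_arcs G v) \<le> n"
proof -
  have "out_arcs G v \<subseteq> {v} \<times> pverts G"
    using arcs_subset by (auto simp: out_arcs_def)
  then have "card (out_arcs G v) \<le> card ({v} \<times> pverts G)"
    using fin by (intro card_mono) auto
  then show ?thesis by (simp add: n card_cartesian_product)
qed

lemma card_in_arcs_le: "card (in_arcs G v) \<le> n"
proof -
  have "in_arcs G v \<subseteq> pverts G \<times> {v}"
    using arcs_subset by (auto simp: in_arcs_def)
  then have "card (in_arcs G v) \<le> card (pverts G \<times> {v})"
    using fin by (intro card_mono) auto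
  then show ?thesis by (simp add: n card_cartesian_product)
qed

lemma card_incident_arcs_le: "card (incident_arcs G v) \<le> 2 * n"
  unfolding incident_arcs_def
  using card_Un_le[of "out_arcs G v" "in_arcs G v"] card_out_arcs_le[of v] card_in_arcs_le[of v]
  by linarith

lemma sum_card_out_arcs: "(\<Sum>v\<in>pverts G. card (out_arcs G v)) = m"
proof -
  have "parcs G = (\<Union>v\<in>pverts G. out_arcs G v)"
    using arcs_subset by (auto simp: out_arcs_def)
  moreover have "card (\<Union>v\<in>pverts G. out_arcs G v) = (\<Sum>v\<in>pverts G. card (out_arcs G v))"
    using fin by (intro card_UN_disjoint) (auto simp: out_arcs_def)
  ultimately show ?thesis by (simp add: m)
qed

lemma m_le: "m \<le> n\<^sup>2"
  using card_mono[OF _ arcs_subset] fin by (simp add: m n card_cartesian_product power2_eq_square)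

text \<open>The cutoff at the degree bounds the code number by \<open>4 * n + 1\<close>, however
  large \<open>\<sigma> v\<close> is.\<close>

lemma length_demand_code: "real (length (nat_code (demand_code (input_of G c \<sigma> v)))) \<le> B"
proof -
  let ?d = "demand_code (input_of G c \<sigma> v)"
  have "int ?d \<le> 4 * int n + 1"
    using int_encode_bound[of "\<sigma> v"] card_incident_arcs_le[of v]
    by (auto simp: demand_code_def card_own_edges)
  then have "?d + 1 \<le> 4 * (n + 1)"
    by simp
  then have "real (?d + 1) \<le> real (4 * (n + 1))"
    by (rule of_nat_mono)
  then have "real ?d + 1 \<le> 4 * (real n + 1)"
    by simp
  then have "log 2 (real ?d + 1) \<le> log 2 (4 * (real n + 1))"
    by simp
  also have "\<dots> = log 2 4 + \<kappa>"
    unfolding \<kappa>_def by (rule log_mult_pos) auto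
  finally have "log 2 (real ?d + 1) \<le> 2 + \<kappa>"
    by (simp add: log_2_4)
  then show ?thesis
    using length_nat_code[of ?d] B_ge \<kappa>_ge_1 by linarith
qed

lemma length_out_code:
  assumes "k \<in> out_codes (input_of G c \<sigma> v)"
  shows "real (length (nat_code k)) \<le> B"
proof -
  obtain e where e: "e \<in> parcs G" "k = prod_encode (snd e, c e)"
    using assms by (auto simp: out_codes_input_of out_arcs_def)
  have "snd e < n ^ a" "c e \<le> W"
    using e ids[of "snd e"] costs[of e] arcs_subset by auto
  \<comment> \<open>The strict bound on \<open>snd e\<close> absorbs the \<open>+ 1\<close> inside
    the square of \<open>prod_encode_bound\<close>.\<close>
  then have "k + 1 \<le> (n ^ a + W)\<^sup>2"
    unfolding e(2) by (intro order_trans[OF prod_encode_bound] power_mono) auto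
  then have "real (k + 1) \<le> real ((n ^ a + W)\<^sup>2)"
    by (rule of_nat_mono)
  then have "real k + 1 \<le> (real n ^ a + real W)\<^sup>2"
    by simp
  \<comment> \<open>Turning the sum into a product lets the logarithm split into a part in
    \<open>n\<close> and a part in \<open>W\<close>.\<close>
  also have "\<dots> \<le> (2 * (real n ^ a * real W))\<^sup>2"
  proof (intro power_mono)
    have "1 \<le> real n ^ a" "1 \<le> real W" using n_pos W_pos by simp_all
    then have "real n ^ a + real W \<le> 1 + real n ^ a * real W" "1 \<le> real n ^ a * real W"
      by (auto intro: add_le_one_add_mult mult_ge1_I)
    then show "real n ^ a + real W \<le> 2 * (real n ^ a * real W)" by simp
  qed auto
  finally have "log 2 (real k + 1) \<le> log 2 ((2 * (real n ^ a * real W))\<^sup>2)"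
    using n_pos W_pos by simp
  also have "\<dots> = 2 * (1 + (real a * log 2 (real n) + log 2 (real W)))"
    using n_pos W_pos by (simp add: log_nat_power log_mult log_2_4)
  also have "\<dots> = 2 * (real a * log 2 (real n) + \<omega>)"
    by (simp add: \<omega>_def)
  also have "\<dots> \<le> 2 * (real a * \<kappa> + \<omega>)"
  proof -
    have "log 2 (real n) \<le> \<kappa>" unfolding \<kappa>_def using n_pos by simp
    then show ?thesis by (simp add: mult_left_mono)
  qed
  finally have log_k: "log 2 (real k + 1) \<le> 2 * (real a * \<kappa> + \<omega>)" .
  have "real (length (nat_code k)) \<le> 2 * log 2 (real k + 1) + 3"
    by (rule length_nat_code)
  also have "\<dots> \<le> 4 * (real a * \<kappa>) + 4 * \<omega> + 3"
    using log_k by (simp add: algebra_simps)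
  also have "\<dots> \<le> 4 * (real a * (\<kappa> * \<omega>)) + 4 * (\<kappa> * \<omega>) + 3 * (\<kappa> * \<omega>)"
    using \<kappa>_\<omega>_ge by (intro add_mono mult_left_mono) auto
  also have "\<dots> \<le> B"
    using \<kappa>_\<omega>_ge(3) by (simp add: B_def algebra_simps)
  finally show ?thesis .
qed

lemma length_encoding:
  "real (length (encoding (input_of G c \<sigma> v))) \<le> (real (card (out_arcs G v)) + 1) * B"
proof -
  let ?i = "input_of G c \<sigma> v"
  have finite: "finite (out_codes ?i)"
    using fin by (simp add: out_codes_input_of out_arcs_def)
  have "real (length (encoding ?i)) \<le>
      real (length (demand_code ?i # sorted_list_of_set (out_codes ?i))) * B"
    unfolding encoding_def using finite length_demand_code length_out_code
    by (intro length_concat_map_le) auto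
  also have "\<dots> \<le> (real (card (out_arcs G v)) + 1) * B"
  proof (intro mult_right_mono)
    have "card (out_codes ?i) \<le> card (out_arcs G v)"
      unfolding out_codes_input_of using fin by (intro card_image_le) (simp add: out_arcs_def)
    then show "real (length (demand_code ?i # sorted_list_of_set (out_codes ?i)))
        \<le> real (card (out_arcs G v)) + 1"
      by simp
  qed (use B_ge \<kappa>_ge_1 in auto)
  finally show ?thesis .
qed

lemma nonempty: "pverts G \<noteq> {}"
  using n n_pos by auto

lemma finish_le:
  "real (gathering.finish encoding (pverts G) (input_of G c \<sigma>)) \<le> 10 * B * (real m / real n + 1)"
proof -
  interpret gathering encoding "pverts G" "input_of G c \<sigma>"
    using nonempty fin by unfold_locales auto
  have B: "9 \<le> B" using B_ge \<kappa>_ge_1 by linarith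
  have n': "1 \<le> real n" using n_pos by simp
  have l: "real (l u) \<le> (real (card (out_arcs G u)) + 1) * B" if "u \<in> pverts G" for u
    using length_encoding[of u] that by (simp add: l_def x_def)
  \<comment> \<open>One node holds at most \<open>n\<close> arc codes and one demand code; all nodes
    together hold \<open>m\<close> arc codes and \<open>n\<close> demand codes.\<close>
  have "real finish \<le> 5 + log 2 ((real n + 1) * B) + ((real n + 1) * B + (real m + real n) * B) / real n"
  proof (rule finish_bound[folded n])
    fix u assume "u \<in> pverts G"
    then show "real (l u) \<le> (real n + 1) * B"
      using card_out_arcs_le[of u] B by (intro order_trans[OF l] mult_right_mono) auto
  next
    show "1 \<le> (real n + 1) * B"
      using B by (intro mult_ge1_I) auto
    have "real (\<Sum>u\<in>pverts G. l u) \<le> (\<Sum>u\<in>pverts G. (real (card (out_arcs G u)) + 1) * B)"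
      unfolding of_nat_sum by (intro sum_mono l)
    also have "\<dots> = (real m + real n) * B"
      by (simp add: sum_card_out_arcs[symmetric] sum.distrib n[symmetric] flip: sum_distrib_right)
    finally show "real (\<Sum>u\<in>pverts G. l u) \<le> (real m + real n) * B" .
  qed
  also have "log 2 ((real n + 1) * B) = \<kappa> + log 2 B"
    using B by (simp add: log_mult \<kappa>_def)
  \<comment> \<open>This crude bound suffices because other terms are already linear in
    \<open>B\<close>.\<close>
  also have "log 2 B \<le> 2 * B"
  proof -
    have "ln B \<le> B * 1"
      using B ln_le_minus_one[of B] by simp
    also have "\<dots> \<le> B * (2 * ln 2)"
      using B ln2_ge_two_thirds by (intro mult_left_mono) auto
    finally show ?thesis
      by (simp add: log_def divide_le_eq mult_ac)
  qed
  also have "((real n + 1) * B + (real m + real n) * B) / real n =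
      2 * B + B / real n + B * (real m / real n)"
    using n' by (simp add: field_simps)
  also have "B / real n \<le> B"
    using n' B by (simp add: divide_le_eq mult_le_cancel_left1)
  finally have "real finish \<le> 5 + \<kappa> + 5 * B + B * (real m / real n)"
    by linarith
  also have "\<dots> \<le> 10 * B + 10 * (B * (real m / real n))"
  proof -
    have "0 \<le> B * (real m / real n)" using B by simp
    then show ?thesis using B B_ge \<kappa>_ge_1 by linarith
  qed
  finally show ?thesis
    by (simp add: algebra_simps)
qed

text \<open>Split \<open>m\<close> into its powers with exponents 3/7 and 4/7 and apply
  \<open>m \<le> n\<^sup>2\<close> to the second one only.\<close>

lemma average_degree_le: "real m / real n \<le> real (max 1 m) powr (3/7) * real n powr (1/7)"
proof (cases "m = 0")
  case False
  have "real m \<le> real (n\<^sup>2)"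
    using m_le by (rule of_nat_mono)
  then have "real m powr (4/7) \<le> (real n powr 2) powr (4/7)"
    using n_pos by (intro powr_mono2) auto
  then have "real m powr (4/7) \<le> real n powr (8/7)"
    unfolding powr_powr by simp
  then have "real m powr (3/7) * real m powr (4/7) \<le> real m powr (3/7) * real n powr (8/7)"
    by (intro mult_left_mono) auto
  moreover have "real n powr (8/7) = real n powr (1/7) * real n"
    using n_pos powr_add[of "real n" "1/7" 1] by simp
  ultimately have "real m \<le> real m powr (3/7) * (real n powr (1/7) * real n)"
    using False by (simp flip: powr_add)
  then show ?thesis
    using False n_pos by (simp add: divide_le_eq max_def mult.assoc)
qed simp

text \<open>The slack \<open>0.158 - 1/7 > 0.015\<close> pays for \<open>\<omega>\<close> unless \<open>\<omega> > n\<^bsup>0.015\<^esup>\<close>, in which case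
  \<open>n\<^bsup>1/7\<^esup> < \<omega>\<^bsup>10\<^esup>\<close>.\<close>

lemma absorb_\<omega>: "\<omega> * real n powr (1/7) \<le> real n powr 0.158 + \<omega> ^ 11"
proof (cases "\<omega> \<le> real n powr 0.015")
  case True
  then have "\<omega> * real n powr (1/7) \<le> real n powr 0.015 * real n powr (1/7)"
    by (intro mult_right_mono) auto
  also have "\<dots> = real n powr (0.015 + 1/7)"
    by (rule powr_add[symmetric])
  also have "\<dots> \<le> real n powr 0.158"
    using n_pos by (intro powr_mono) auto
  finally show ?thesis
    using \<omega>_ge_1 by (simp add: add_increasing2)
next
  case False
  have "real n powr (1/7) \<le> real n powr 0.15"
    using n_pos by (intro powr_mono) auto
  also have "\<dots> = (real n powr 0.015) powr 10"
    by (simp add: powr_powr)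
  also have "\<dots> \<le> \<omega> powr 10"
    using False by (intro powr_mono2) auto
  also have "\<dots> = \<omega> ^ 10"
    using \<omega>_ge_1 by simp
  finally have "\<omega> * real n powr (1/7) \<le> \<omega> * \<omega> ^ 10"
    using \<omega>_ge_1 by (intro mult_left_mono) auto
  moreover have "\<omega> * \<omega> ^ 10 = \<omega> ^ 11"
    by (simp flip: power_Suc)
  ultimately show ?thesis
    by (simp add: add_increasing)
qed

lemma rounds_le:
  "real (gathering.finish encoding (pverts G) (input_of G c \<sigma>)) \<le>
    20 * (4 * real a + 9) * log 2 (real n + 1) ^ 1 *
      (real (max 1 m) powr (3/7) *
        (real n powr 0.158 + real n powr 0 * poly ([:1, 1:] ^ 11) (log 2 (real W))))"
proof -
  let ?M = "real (max 1 m) powr (3/7)"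
  \<comment> \<open>Thanks to \<open>max 1 m\<close> the product is at least 1 even without arcs, so
    the additive 1 costs only a factor 2.\<close>
  have "1 * 1 \<le> ?M * real n powr (1/7)"
    using n_pos by (intro mult_mono ge_one_powr_ge_zero) auto
  then have "real m / real n + 1 \<le> 2 * (?M * real n powr (1/7))"
    using average_degree_le by simp
  then have "10 * B * (real m / real n + 1) \<le> 10 * B * (2 * (?M * real n powr (1/7)))"
    using B_ge \<kappa>_ge_1 by (intro mult_left_mono) auto
  also have "\<dots> = 20 * (4 * real a + 9) * \<kappa> * (?M * (\<omega> * real n powr (1/7)))"
    by (simp add: B_def)
  also have "\<dots> \<le> 20 * (4 * real a + 9) * \<kappa> * (?M * (real n powr 0.158 + \<omega> ^ 11))"
    using \<kappa>_ge_1 by (intro mult_left_mono absorb_\<omega>) auto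
  \<comment> \<open>\<open>[:1, 1:]\<close> is the polynomial 1 + X, whose value at
    \<open>log 2 W\<close> is \<open>\<omega>\<close>. The exponent 0 anticipates the zero sequence
    as witness for \<open>\<epsilon>\<close>.\<close>
  also have "\<omega> ^ 11 = real n powr 0 * poly ([:1, 1:] ^ 11) (log 2 (real W))"
    using n_pos by (simp add: poly_power \<omega>_def)
  finally show ?thesis
    using finish_le by (simp add: \<kappa>_def)
qed

end

theorem theorem1p3:
  fixes a :: nat
  shows "\<exists>(A :: cc_algorithm) (b :: nat) (C :: real) (k :: nat) (p :: real poly) (\<epsilon> :: nat \<Rightarrow> real).
    \<epsilon> \<longlonglongrightarrow> 0 \<and>
    (\<forall>(G :: nat pair_pre_digraph) (c :: nat \<times> nat \<Rightarrow> nat) (\<sigma> :: nat \<Rightarrow> int) (n :: nat) (m :: nat) (W :: nat).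
       pair_fin_digraph G \<and> n = card (pverts G) \<and> m = card (parcs G) \<and> 1 \<le> n \<and> 1 \<le> W \<and>
       (\<forall>v\<in>pverts G. v < n ^ a) \<and>
       (\<forall>e\<in>parcs G. c e \<in> {1..W}) \<and>
       (\<Sum>v\<in>pverts G. \<sigma> v) = 0 \<longrightarrow>
       (\<exists>T. solves_min_cost_flow b A G c \<sigma> T \<and>
          real T \<le> C * log 2 (real n + 1) ^ k *
            (real (max 1 m) powr (3/7) *
              (real n powr 0.158 + real n powr \<epsilon> n * poly p (log 2 (real W))))))"
proof (rule exI[of _ gather_and_solve], rule exI[of _ 1], rule exI[of _ "20 * (4 * real a + 9)"],
    rule exI[of _ 1], rule exI[of _ "[:1, 1:] ^ 11"], rule exI[of _ "\<lambda>_. 0"],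
    intro conjI allI impI tendsto_const)
  fix G :: "nat pair_pre_digraph" and c :: "nat \<times> nat \<Rightarrow> nat" and \<sigma> :: "nat \<Rightarrow> int"
    and n m W :: nat
  assume "pair_fin_digraph G \<and> n = card (pverts G) \<and> m = card (parcs G) \<and> 1 \<le> n \<and> 1 \<le> W \<and>
       (\<forall>v\<in>pverts G. v < n ^ a) \<and>
       (\<forall>e\<in>parcs G. c e \<in> {1..W}) \<and>
       (\<Sum>v\<in>pverts G. \<sigma> v) = 0"
  then interpret instance_bounds G c \<sigma> a n m W
    by (intro instance_bounds.intro) auto
  show "\<exists>T. solves_min_cost_flow 1 gather_and_solve G c \<sigma> T \<and>
      real T \<le> 20 * (4 * real a + 9) * log 2 (real n + 1) ^ 1 *
        (real (max 1 m) powr (3/7) *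
          (real n powr 0.158 + real n powr 0 * poly ([:1, 1:] ^ 11) (log 2 (real W))))"
    using gather_and_solve_correct[OF digraph nonempty] rounds_le by blast
qed

end
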